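(* Let $n$ be even. The perimeter function $\mathcal{P}(\mathbf{P})=\sum_{i=1}^n|P_i-P_{i-1}|$ on plane $n$-gons is invariant under the flow of the vector field $\xi$.
   Context: A plane $n$-gon is an $n$-tuple $\mathbf{P}=(P_1,\dots,P_n)$ of points in $\mathbb{R}^2$ with $P_i\ne P_{i+1}$ for all $i$; indices are cyclic mod $n$. The vector field $\xi=(\xi_1,\dots,\xi_n)$ moves the vertex $P_i$ with velocity $$\xi_i=\frac12\left(\frac{P_i-P_{i-1}}{|P_i-P_{i-1}|}-\frac{P_i-P_{i+1}}{|P_i-P_{i+1}|}\right).$$ *)

theory Defs
  imports "HOL-Analysis.Analysis"
begin

text \<open>
  An n-tuple of points in the plane is a function on nat of which only the values at
  0, ..., n - 1 matter; indices are cyclic modulo n.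
\<close>

type_synonym tuple = "nat \<Rightarrow> real ^ 2"

definition nxt :: "nat \<Rightarrow> nat \<Rightarrow> nat" where
  "nxt n i = (i + 1) mod n"

text \<open>Adding n first avoids the truncated subtraction at i = 0.\<close>

definition prv :: "nat \<Rightarrow> nat \<Rightarrow> nat" where
  "prv n i = (i + n - 1) mod n"

definition plane_ngon :: "nat \<Rightarrow> tuple \<Rightarrow> bool" where
  "plane_ngon n P \<longleftrightarrow> (\<forall>i<n. P i \<noteq> P (nxt n i))"

definition xi :: "nat \<Rightarrow> tuple \<Rightarrow> tuple" where
  "xi n P i = (1 / 2) *\<^sub>R
     ((P i - P (prv n i)) /\<^sub>R norm (P i - P (prv n i))
      - (P i - P (nxt n i)) /\<^sub>R norm (P i - P (nxt n i)))"

definition perimeter :: "nat \<Rightarrow> tuple \<Rightarrow> real" where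
  "perimeter n P = (\<Sum>i<n. norm (P i - P (prv n i)))"

text \<open>
  Integral curves of xi on a set of times T. The curve has to stay in the space of n-gons, the
  domain of xi. At an end point of T the derivative is one-sided.
\<close>

definition integral_curve :: "nat \<Rightarrow> (real \<Rightarrow> tuple) \<Rightarrow> real set \<Rightarrow> bool" where
  "integral_curve n \<gamma> T \<longleftrightarrow>
     (\<forall>t\<in>T. plane_ngon n (\<gamma> t) \<and>
        (\<forall>i<n. ((\<lambda>s. \<gamma> s i) has_vector_derivative xi n (\<gamma> t) i) (at t within T)))"

text \<open>
  The graph of the time-t map of the (local) flow of xi: P is carried to Q in time t. The time
  may be negative. No completeness is assumed: if the solution starting at P does not exist up
  to time t, then P is not related to any Q.
\<close>

definition flows_to :: "nat \<Rightarrow> real \<Rightarrow> tuple \<Rightarrow> tuple \<Rightarrow> bool" where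
  "flows_to n t P Q \<longleftrightarrow>
     (\<exists>\<gamma>. integral_curve n \<gamma> (closed_segment 0 t) \<and> \<gamma> 0 = P \<and> \<gamma> t = Q)"

end

theory Submission imports Defs begin

text \<open>
  With the unit edge vectors \<open>u i\<close> along \<open>P i - P (i - 1)\<close> the field reads
  \<open>(u i + u (i + 1)) / 2\<close>, so the \<open>i\<close>-th edge length changes at the rate
  \<open>(u i \<bullet> u (i + 1) - u (i - 1) \<bullet> u i) / 2\<close>, and these rates telescope around the cycle.
\<close>

lemma prv_less: "i < n \<Longrightarrow> prv n i < n"
  by (simp add: prv_def)

lemma nxt_prv: "i < n \<Longrightarrow> nxt n (prv n i) = i"
  by (simp add: nxt_def prv_def mod_simps)

lemma prv_nxt: "i < n \<Longrightarrow> prv n (nxt n i) = i"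
  by (cases "Suc i = n") (simp_all add: nxt_def prv_def)

lemma bij_betw_prv: "bij_betw (prv n) {..<n} {..<n}"
  by (rule bij_betw_byWitness[where f' = "nxt n"])
    (auto simp: nxt_prv prv_nxt prv_less, simp add: nxt_def)

text \<open>A cyclic shift permutes the indices; this makes a sum of differences
  \<open>f i - f (prv n i)\<close> vanish.\<close>

lemma sum_prv: "(\<Sum>i<n. f (prv n i)) = (\<Sum>i<n. f i)"
  by (rule sum.reindex_bij_betw[OF bij_betw_prv])

text \<open>Written with \<open>sgn\<close> because that is the gradient of the norm away from 0.
  The edge leaving vertex \<open>i\<close> has index \<open>nxt n i\<close>.\<close>

definition unit_edge :: "nat \<Rightarrow> tuple \<Rightarrow> tuple" where
  "unit_edge n P i = sgn (P i - P (prv n i))"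

lemma xi_eq_unit_edge:
  assumes "i < n"
  shows "xi n P i = (1 / 2) *\<^sub>R (unit_edge n P i + unit_edge n P (nxt n i))"
proof -
  \<comment> \<open>This quotient points from the next vertex back to \<open>P i\<close>; the sign
    change turns the difference in \<open>xi\<close> into a sum.\<close>
  have "(P i - P (nxt n i)) /\<^sub>R norm (P i - P (nxt n i)) = - unit_edge n P (nxt n i)"
    using prv_nxt[OF assms]
    by (simp add: unit_edge_def sgn_div_norm norm_minus_commute flip: scaleR_minus_right)
  then show ?thesis
    by (simp add: xi_def unit_edge_def sgn_div_norm)
qed

lemma xi_edge_rates_sum_zero:
  "(\<Sum>i<n. unit_edge n P i \<bullet> (xi n P i - xi n P (prv n i))) = 0"
proof -
  let ?u = "unit_edge n P"
  \<comment> \<open>The two copies of \<open>?u i \<bullet> ?u i\<close> cancel. Writing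
    \<open>i\<close> as \<open>nxt n (prv n i)\<close> exhibits the subtracted term as the first one
    shifted by \<open>prv n\<close>.\<close>
  have "(\<Sum>i<n. ?u i \<bullet> (xi n P i - xi n P (prv n i)))
      = (\<Sum>i<n. (?u i \<bullet> ?u (nxt n i) - ?u (prv n i) \<bullet> ?u (nxt n (prv n i))) / 2)"
    by (rule sum.cong)
      (auto simp: xi_eq_unit_edge prv_less nxt_prv inner_diff_right inner_add_right
        inner_commute field_simps)
  also have "\<dots> = 0"
    by (simp add: sum_subtractf sum_prv[where f = "\<lambda>i. ?u i \<bullet> ?u (nxt n i)"]
        flip: sum_divide_distrib)
  finally show ?thesis .
qed

lemma perimeter_derivative_zero:
  assumes curve: "integral_curve n \<gamma> T" and t: "t \<in> T"
  shows "((\<lambda>s. perimeter n (\<gamma> s)) has_derivative (\<lambda>h. 0)) (at t within T)"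
proof -
  let ?P = "\<gamma> t"
  have vel: "((\<lambda>s. \<gamma> s i) has_derivative (\<lambda>h. h *\<^sub>R xi n ?P i)) (at t within T)" if "i < n" for i
    using curve t that by (auto simp: integral_curve_def has_vector_derivative_def)
  have edge: "((\<lambda>s. norm (\<gamma> s i - \<gamma> s (prv n i))) has_derivative
      (\<lambda>h. h * (unit_edge n ?P i \<bullet> (xi n ?P i - xi n ?P (prv n i))))) (at t within T)"
    if i: "i < n" for i
  proof -
    \<comment> \<open>The norm is not differentiable at 0. \<open>plane_ngon\<close> separates each
      vertex from its successor, so it is applied at \<open>prv n i\<close>.\<close>
    have "?P (prv n i) \<noteq> ?P (nxt n (prv n i))"
      using curve t prv_less[OF i] by (auto simp: integral_curve_def plane_ngon_def)
    then have "?P i - ?P (prv n i) \<noteq> 0"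
      by (simp add: nxt_prv[OF i])
    from has_derivative_compose[OF has_derivative_diff[OF vel[OF i] vel[OF prv_less[OF i]]]
        has_derivative_norm[OF this]]
    show ?thesis
      by (simp add: unit_edge_def inner_commute flip: scaleR_diff_right)
  qed
  have "((\<lambda>s. perimeter n (\<gamma> s)) has_derivative
      (\<lambda>h. \<Sum>i<n. h * (unit_edge n ?P i \<bullet> (xi n ?P i - xi n ?P (prv n i))))) (at t within T)"
    unfolding perimeter_def using edge by (intro has_derivative_sum) auto
  then show ?thesis
    by (simp add: xi_edge_rates_sum_zero flip: sum_distrib_left)
qed

theorem lemma5p2:
  fixes n :: nat and t :: real and P Q :: tuple
  assumes "n > 0" and "even n"
    and "plane_ngon n P"
    and "flows_to n t P Q"
  shows "perimeter n Q = perimeter n P"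
proof -
  from assms(4) obtain \<gamma> where curve: "integral_curve n \<gamma> (closed_segment 0 t)"
    and ends: "\<gamma> 0 = P" "\<gamma> t = Q"
    by (auto simp: flows_to_def)
  \<comment> \<open>The segment is convex for either sign of \<open>t\<close>, so a zero derivative
    within it, one-sided at the ends, forces constancy.\<close>
  have "\<exists>c. \<forall>s\<in>closed_segment 0 t. perimeter n (\<gamma> s) = c"
    using perimeter_derivative_zero[OF curve]
    by (intro has_derivative_zero_constant) auto
  then have "perimeter n (\<gamma> t) = perimeter n (\<gamma> 0)"
    by auto
  then show ?thesis
    using ends by simp
qed

end
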